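(* Let $\mathbf{A}=(a_k)_{k=0}^\infty$ be a nonnegative real sequence whose generating function $A(z)=\sum_{k=0}^\infty a_k z^k$ is a meromorphic function with at least one pole. Then the following are equivalent: (i) for every $(b_k)_{k=0}^\infty\in TP_\infty$ we have $\Lambda_{\mathbf{A}}((b_k)_{k=0}^\infty)\in TP_\infty$; (ii) $A(z)=\dfrac{C}{1-\beta z}$ for some real constants $C>0$ and $\beta>0$.
   Context: A real sequence $(c_k)_{k=0}^\infty$ is called totally positive if all minors (of all finite orders) of the infinite upper triangular Toeplitz matrix $\|c_{j-i}\|_{i,j=0}^\infty$ (with $c_k=0$ for $k<0$) are nonnegative. The set of totally positive sequences is denoted $TP_\infty$. For a nonnegative sequence $\mathbf{A}=(a_k)_{k=0}^\infty$, the operator $\Lambda_{\mathbf{A}}$ acts on real sequences by $\Lambda_{\mathbf{A}}((b_k)_{k=0}^\infty)=(a_kb_k)_{k=0}^\infty$. That the generating function is meromorphic means that the power series $\sum_k a_kz^k$ has a positive radius of convergence and its sum extends to a meromorphic function on $\mathbb{C}$, again denoted $A$. *)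

theory Defs
  imports
    "HOL-Complex_Analysis.Complex_Analysis"
    "Jordan_Normal_Form.Determinant"
begin

definition toeplitz_entry :: "(nat \<Rightarrow> real) \<Rightarrow> nat \<Rightarrow> nat \<Rightarrow> real" where
  "toeplitz_entry c i j = (if i \<le> j then c (j - i) else 0)"

(* The minors of order n are indexed by strictly increasing choices of n rows r(0) < ... < r(n-1)
   and n columns s(0) < ... < s(n-1); only the values of r and s below n matter. The case n = 0
   is harmless, since the empty determinant is 1. *)
definition TP_infinity :: "(nat \<Rightarrow> real) set" where
  "TP_infinity = {c. \<forall>n r s. strict_mono_on {..<n} r \<longrightarrow> strict_mono_on {..<n} s \<longrightarrow>
     Determinant.det (Matrix.mat n n (\<lambda>(p, q). toeplitz_entry c (r p) (s q))) \<ge> 0}"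

definition Lambda_op :: "(nat \<Rightarrow> real) \<Rightarrow> (nat \<Rightarrow> real) \<Rightarrow> (nat \<Rightarrow> real)" where
  "Lambda_op a b = (\<lambda>k. a k * b k)"

(* A is the meromorphic function on the whole plane extending the sum of the power series.
   "Nicely" only normalises the values of the total function A: it has no removable
   singularities, and it takes the dummy value 0 at its poles. *)
definition meromorphic_generating_function ::
    "(nat \<Rightarrow> real) \<Rightarrow> (complex \<Rightarrow> complex) \<Rightarrow> bool" where
  "meromorphic_generating_function a A \<longleftrightarrow>
     conv_radius a > 0 \<and> A nicely_meromorphic_on UNIV \<and>
     (\<forall>z\<in>eball 0 (conv_radius a). (\<lambda>k. complex_of_real (a k) * z ^ k) sums A z)"

end

theory Submission
  imports Defs "HOL-Real_Asymp.Real_Asymp"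
begin

text \<open>
  For \<open>a\<^sub>k = C \<beta>\<^sup>k\<close>, each minor of the image of \<open>b\<close> is a positive multiple of the corresponding minor
  of \<open>b\<close>, so the operator preserves total positivity
  (lemma \<open>TP_infinity_geometric_scale\<close>).

  For the converse, a pole of \<open>A\<close> enters only through the fact that the radius of convergence is
  finite. Applying the operator to the constant sequence 1 shows that \<open>a\<close> itself is totally positive.
  Its minors of order 2 make it log-concave, so the ratios \<open>a\<^sub>k\<^sub>+\<^sub>1 / a\<^sub>k\<close> converge, and a rescaling
  makes the limit 1. The decisive tool is the convexity lemma \<open>TP_infinity_backward_diff_mono\<close>,
  obtained from minors of order 3 whose last columns run to infinity: if \<open>c\<close> is totally positive,
  its ratios tend to 1, and the ratios of its differences \<open>d\<^sub>k = c\<^sub>k - c\<^sub>k\<^sub>-\<^sub>1\<close> have a limit of at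
  least 1, then \<open>d\<close> is increasing, where \<open>c\<^sub>-\<^sub>1 = 0\<close>.

  Let \<open>d\<close> now denote the differences of the rescaled sequence \<open>a\<close>. If \<open>\<Sum> k d\<^sub>k\<close> converges, as it does
  when \<open>A\<close> has a simple pole at 1, convexity of the image \<open>((k + 1) a\<^sub>k)\<^sub>k\<close> of \<open>(k + 1)\<^sub>k\<close> forces \<open>a\<close> to be
  constant. If the sum diverges, as it does for a pole at 1 of higher order, the lemma applies to the images
  \<open>(0, \<dots>, 0, a\<^sub>j, a\<^sub>j\<^sub>+\<^sub>1, \<dots>)\<close> of the step sequences and yields \<open>a\<^sub>j\<^sub>+\<^sub>1 \<ge> 2 a\<^sub>j\<close> for all \<open>j\<close>, which
  contradicts the ratio limit 1 (lemma \<open>TP_preserver_ratio_one_imp_const\<close>).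

  The test sequences have the generating functions \<open>z\<^sup>m / (1 - z)\<close> and \<open>1 / (1 - z)\<^sup>2\<close>. Their total
  positivity follows from that of \<open>(1, 0, 0, \<dots>)\<close>, because shifts and partial sums of totally positive
  sequences are totally positive.
\<close>

section \<open>Totally positive test sequences\<close>

text \<open>The minor of the Toeplitz matrix of \<open>c\<close> with rows \<open>r 0, \<dots>, r (n - 1)\<close> and columns \<open>s 0, \<dots>, s (n - 1)\<close>.\<close>
definition toeplitz_minor :: "(nat \<Rightarrow> real) \<Rightarrow> nat \<Rightarrow> (nat \<Rightarrow> nat) \<Rightarrow> (nat \<Rightarrow> nat) \<Rightarrow> real" where
  "toeplitz_minor c n r s =
     Determinant.det (Matrix.mat n n (\<lambda>(p, q). toeplitz_entry c (r p) (s q)))"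

lemma TP_infinityI:
  assumes "\<And>n r s. strict_mono_on {..<n} r \<Longrightarrow> strict_mono_on {..<n} s \<Longrightarrow> toeplitz_minor c n r s \<ge> 0"
  shows "c \<in> TP_infinity"
  using assms by (simp add: TP_infinity_def toeplitz_minor_def)

lemma TP_infinityD:
  assumes "c \<in> TP_infinity" "strict_mono_on {..<n} r" "strict_mono_on {..<n} s"
  shows "toeplitz_minor c n r s \<ge> 0"
  using assms by (simp add: TP_infinity_def toeplitz_minor_def)

lemma toeplitz_minor_leibniz:
  "toeplitz_minor c n r s =
     (\<Sum>p | p permutes {0..<n}. signof p * (\<Prod>i = 0..<n. toeplitz_entry c (r i) (s (p i))))"
proof -
  have "Matrix.mat n n (\<lambda>(p, q). toeplitz_entry c (r p) (s q)) $$ (i, p i) = toeplitz_entry c (r i) (s (p i))"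
    if "p permutes {0..<n}" "i \<in> {0..<n}" for p i
    using that permutes_in_image[OF that(1), of i] by simp
  then show ?thesis
    unfolding toeplitz_minor_def by (subst det_def'[of _ n]) (auto intro!: sum.cong prod.cong)
qed

lemma TP_infinity_geometric_scale:
  fixes C \<beta> :: real
  assumes c: "c \<in> TP_infinity" and C: "C \<ge> 0" and \<beta>: "\<beta> > 0"
  shows "(\<lambda>k. C * \<beta> ^ k * c k) \<in> TP_infinity"
proof (rule TP_infinityI)
  fix n and r s :: "nat \<Rightarrow> nat"
  assume rs: "strict_mono_on {..<n} r" "strict_mono_on {..<n} s"
  let ?K = "C ^ n * (\<Prod>i<n. \<beta> ^ s i) / (\<Prod>i<n. \<beta> ^ r i)"
  have entry: "toeplitz_entry (\<lambda>k. C * \<beta> ^ k * c k) i j = C * \<beta> ^ j / \<beta> ^ i * toeplitz_entry c i j" for i j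
    using \<beta> by (auto simp: toeplitz_entry_def power_diff)
  have "toeplitz_minor (\<lambda>k. C * \<beta> ^ k * c k) n r s = ?K * toeplitz_minor c n r s"
  proof -
    have "(\<Prod>i = 0..<n. toeplitz_entry (\<lambda>k. C * \<beta> ^ k * c k) (r i) (s (p i)))
        = ?K * (\<Prod>i = 0..<n. toeplitz_entry c (r i) (s (p i)))" if p: "p permutes {0..<n}" for p
    proof -
      have "(\<Prod>i = 0..<n. \<beta> ^ s (p i)) = (\<Prod>i = 0..<n. \<beta> ^ s i)"
        using prod.permute[OF p, of "\<lambda>i. \<beta> ^ s i"] by (simp add: o_def)
      then show ?thesis
        by (simp add: entry prod.distrib prod_dividef atLeast0LessThan)
    qed
    then show ?thesis
      unfolding toeplitz_minor_leibniz sum_distrib_left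
      by (intro sum.cong refl) (simp only: mem_Collect_eq mult.left_commute)
  qed
  moreover have "?K \<ge> 0" using C \<beta> by (intro divide_nonneg_nonneg mult_nonneg_nonneg prod_nonneg) auto
  ultimately show "toeplitz_minor (\<lambda>k. C * \<beta> ^ k * c k) n r s \<ge> 0"
    using TP_infinityD[OF c rs] by (metis mult_nonneg_nonneg)
qed

lemma TP_infinity_delta: "(\<lambda>k. if k = 0 then 1 else 0) \<in> TP_infinity"
proof (rule TP_infinityI)
  fix n and r s :: "nat \<Rightarrow> nat"
  assume r: "strict_mono_on {..<n} r" and s: "strict_mono_on {..<n} s"
  let ?c = "\<lambda>k::nat. if k = 0 then 1 else (0::real)"
  let ?A = "Matrix.mat n n (\<lambda>(p, q). toeplitz_entry ?c (r p) (s q))"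
  have entry: "toeplitz_entry ?c i j = (if i = j then 1 else 0)" for i j
    by (auto simp: toeplitz_entry_def)
  show "toeplitz_minor ?c n r s \<ge> 0"
  proof (cases "\<forall>p<n. r p = s p")
    case True
    have "?A = 1\<^sub>m n"
      by (rule eq_matI) (use True strict_mono_on_eqD[OF s] in \<open>auto simp: entry\<close>)
    then show ?thesis by (simp add: toeplitz_minor_def)
  next
    case False
    \<comment> \<open>At the first index where rows and columns differ, the smaller of the two selects a zero row or column.\<close>
    define p where "p = (LEAST p. p < n \<and> r p \<noteq> s p)"
    have p: "p < n" "r p \<noteq> s p"
      using LeastI_ex[of "\<lambda>p. p < n \<and> r p \<noteq> s p"] False by (auto simp: p_def)
    have below: "r q = s q" if "q < p" for q
      using not_less_Least[of q "\<lambda>p. p < n \<and> r p \<noteq> s p"] that p(1) by (auto simp: p_def)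
    have mr: "r x < r y" and ms: "s x < s y" if "x < y" "y < n" for x y
      using that r s by (auto simp: strict_mono_on_def)
    have "Determinant.det ?A = 0"
    proof (cases "r p < s p")
      case True
      have "r p \<noteq> s q" if "q < n" for q
        using below[of q] mr[of q p] ms[of p q] True p that by (cases q p rule: linorder_cases) auto
      then have "?A $$ (p, q) = 0" if "q < n" for q
        using that p by (simp add: entry)
      then show ?thesis
        by (subst laplace_expansion_row[of _ n p]) (use p in auto)
    next
      case False
      have "r q \<noteq> s p" if "q < n" for q
        using below[of q] ms[of q p] mr[of p q] False p that by (cases q p rule: linorder_cases) auto
      then have "?A $$ (q, p) = 0" if "q < n" for q
        using that p by (simp add: entry)
      then show ?thesis
        by (subst laplace_expansion_column[of _ n p]) (use p in auto)
    qed
    then show ?thesis by (simp add: toeplitz_minor_def)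
  qed
qed

lemma TP_infinity_shift:
  assumes c: "c \<in> TP_infinity"
  shows "(\<lambda>k. if m \<le> k then c (k - m) else 0) \<in> TP_infinity"
proof (rule TP_infinityI)
  fix n and r s :: "nat \<Rightarrow> nat"
  assume r: "strict_mono_on {..<n} r" and s: "strict_mono_on {..<n} s"
  have "toeplitz_entry (\<lambda>k. if m \<le> k then c (k - m) else 0) i j = toeplitz_entry c (i + m) j" for i j
    by (auto simp: toeplitz_entry_def algebra_simps)
  then have "toeplitz_minor (\<lambda>k. if m \<le> k then c (k - m) else 0) n r s = toeplitz_minor c n (\<lambda>p. r p + m) s"
    by (simp add: toeplitz_minor_def)
  moreover have "strict_mono_on {..<n} (\<lambda>p. r p + m)"
    using r by (auto simp: strict_mono_on_def)
  ultimately show "toeplitz_minor (\<lambda>k. if m \<le> k then c (k - m) else 0) n r s \<ge> 0"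
    using TP_infinityD[OF c _ s] by simp
qed

text \<open>Additivity of the determinant in column \<open>k\<close>.\<close>
lemma det_sum_column:
  fixes f :: "'b \<Rightarrow> nat \<Rightarrow> 'a :: comm_ring_1"
  assumes "k < n"
  shows "Determinant.det (Matrix.mat n n (\<lambda>(p, q). if q = k then \<Sum>l\<in>S. f l p else g p q)) =
    (\<Sum>l\<in>S. Determinant.det (Matrix.mat n n (\<lambda>(p, q). if q = k then f l p else g p q)))"
proof -
  let ?A = "\<lambda>h. Matrix.mat n n (\<lambda>(p, q). if q = k then h p else g p q)"
  have del: "mat_delete (?A h) i k = mat_delete (?A (\<lambda>_. 0)) i k" for h i
    by (rule eq_matI) (auto simp: mat_delete_def)
  have "Determinant.det (?A h) = (\<Sum>i<n. h i * cofactor (?A (\<lambda>_. 0)) i k)" for h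
    by (subst laplace_expansion_column[of _ n k])
      (use assms in \<open>auto simp: cofactor_def del[of h] intro!: sum.cong\<close>)
  then show ?thesis
    by (simp add: sum_distrib_right) (rule sum.swap)
qed

text \<open>
  If each column is a sum of columns of \<open>T\<close> over a block \<open>B q\<close>, and the blocks are ordered, then
  multilinearity expands the determinant into minors of \<open>T\<close> with increasing columns.
\<close>
lemma det_ordered_column_sums_nonneg:
  fixes T :: "nat \<Rightarrow> nat \<Rightarrow> real"
  assumes minors: "\<And>s. strict_mono_on {..<n} s \<Longrightarrow> Determinant.det (Matrix.mat n n (\<lambda>(p, q). T p (s q))) \<ge> 0"
    and "\<And>q q' l l'. q < q' \<Longrightarrow> q' < n \<Longrightarrow> l \<in> B q \<Longrightarrow> l' \<in> B q' \<Longrightarrow> l < l'"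
  shows "Determinant.det (Matrix.mat n n (\<lambda>(p, q). \<Sum>l\<in>B q. T p l)) \<ge> 0"
proof -
  have "Determinant.det (Matrix.mat n n (\<lambda>(p, q). \<Sum>l\<in>B q. T p l)) \<ge> 0"
    if "m \<le> n" "\<And>q q' l l'. q < q' \<Longrightarrow> q' < n \<Longrightarrow> l \<in> B q \<Longrightarrow> l' \<in> B q' \<Longrightarrow> l < l'"
      "\<And>q. m \<le> q \<Longrightarrow> q < n \<Longrightarrow> \<exists>l. B q = {l}" for m B
    \<comment> \<open>Induction on the number \<open>m\<close> of leading columns that may be proper sums.\<close>
    using that
  proof (induction m arbitrary: B)
    case 0
    define s where "s q = the_elem (B q)" for q
    have B: "B q = {s q}" if "q < n" for q
      using 0(3)[OF _ that] unfolding s_def by (metis le0 the_elem_eq)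
    have "strict_mono_on {..<n} s"
      using 0(2) B by (auto simp: strict_mono_on_def)
    moreover have "Matrix.mat n n (\<lambda>(p, q). \<Sum>l\<in>B q. T p l) = Matrix.mat n n (\<lambda>(p, q). T p (s q))"
      by (rule eq_matI) (auto simp: B)
    ultimately show ?case using minors by simp
  next
    case (Suc m)
    have "Matrix.mat n n (\<lambda>(p, q). \<Sum>l\<in>B q. T p l) =
        Matrix.mat n n (\<lambda>(p, q). if q = m then \<Sum>l\<in>B m. T p l else \<Sum>l\<in>B q. T p l)"
      by (rule eq_matI) auto
    then have "Determinant.det (Matrix.mat n n (\<lambda>(p, q). \<Sum>l\<in>B q. T p l)) =
      (\<Sum>l\<in>B m. Determinant.det (Matrix.mat n n (\<lambda>(p, q). if q = m then T p l else \<Sum>l\<in>B q. T p l)))"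
      using Suc.prems(1) det_sum_column[where S = "B m" and f = "\<lambda>l p. T p l" and k = m and n = n
          and g = "\<lambda>p q. \<Sum>l\<in>B q. T p l"] by simp
    also have "\<dots> \<ge> 0"
    proof (rule sum_nonneg)
      fix l assume l: "l \<in> B m"
      have "Determinant.det (Matrix.mat n n (\<lambda>(p, q). \<Sum>l\<in>(B(m := {l})) q. T p l)) \<ge> 0"
      proof (rule Suc.IH)
        show "m \<le> n" using Suc.prems(1) by simp
        show "x < y" if "q < q'" "q' < n" "x \<in> (B(m := {l})) q" "y \<in> (B(m := {l})) q'" for q q' x y
          using Suc.prems(2)[OF that(1,2), of x y] l that(3,4) by (auto split: if_splits)
        show "\<exists>x. (B(m := {l})) q = {x}" if "m \<le> q" "q < n" for q
          using Suc.prems(3)[of q] that by (cases "q = m") auto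
      qed
      also have "Matrix.mat n n (\<lambda>(p, q). \<Sum>l\<in>(B(m := {l})) q. T p l) =
          Matrix.mat n n (\<lambda>(p, q). if q = m then T p l else \<Sum>l\<in>B q. T p l)"
        by (rule eq_matI) auto
      finally show "Determinant.det (Matrix.mat n n (\<lambda>(p, q). if q = m then T p l else \<Sum>l\<in>B q. T p l)) \<ge> 0" .
    qed
    finally show ?case .
  qed
  note * = this
  show ?thesis
  proof (rule *[OF le_refl])
    show "l < l'" if "q < q'" "q' < n" "l \<in> B q" "l' \<in> B q'" for q q' l l'
      using assms(2) that by blast
  qed auto
qed

text \<open>
  Summation multiplies the generating function by \<open>1 / (1 - z)\<close>. A column of the new Toeplitz matrix
  is the sum of all columns of the old one up to the same index; subtracting from each chosen column its
  predecessor leaves sums over the disjoint blocks between consecutive chosen columns.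
\<close>
lemma TP_infinity_partial_sums:
  assumes c: "c \<in> TP_infinity"
  shows "(\<lambda>k. \<Sum>i\<le>k. c i) \<in> TP_infinity"
proof (rule TP_infinityI)
  fix n and r s :: "nat \<Rightarrow> nat"
  assume r: "strict_mono_on {..<n} r" and s: "strict_mono_on {..<n} s"
  let ?c = "\<lambda>k. \<Sum>i\<le>k. c i"
  define B where "B q = (if q = 0 then {..s 0} else {s (q - 1)<..s q})" for q
  have entry: "toeplitz_entry ?c i j = (\<Sum>l\<le>j. toeplitz_entry c i l)" for i j
  proof (cases "i \<le> j")
    case True
    have "(\<Sum>l\<le>j. toeplitz_entry c i l) = (\<Sum>l\<in>{i..j}. c (l - i))"
      using True by (intro sum.mono_neutral_cong_right) (auto simp: toeplitz_entry_def)
    also have "\<dots> = (\<Sum>k\<le>j - i. c k)"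
      by (rule sum.reindex_bij_witness[of _ "\<lambda>k. k + i" "\<lambda>l. l - i"]) (use True in auto)
    finally show ?thesis using True by (simp add: toeplitz_entry_def)
  qed (auto simp: toeplitz_entry_def)
  have mono: "s x \<le> s y" if "x \<le> y" "y < n" for x y
    using s that by (auto simp: strict_mono_on_def order.order_iff_strict)
  have blocks: "(\<Sum>q'\<le>q. \<Sum>l\<in>B q'. f l) = (\<Sum>l\<le>s q. f l)" if "q < n" for q and f :: "nat \<Rightarrow> real"
    using that
  proof (induction q)
    case 0
    then show ?case by (simp add: B_def)
  next
    case (Suc q)
    have "(\<Sum>q'\<le>Suc q. \<Sum>l\<in>B q'. f l) = (\<Sum>l\<in>{..s q} \<union> {s q<..s (Suc q)}. f l)"
      using Suc by (subst sum.union_disjoint) (auto simp: B_def)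
    also have "{..s q} \<union> {s q<..s (Suc q)} = {..s (Suc q)}"
      using mono[of q "Suc q"] Suc.prems by auto
    finally show ?case .
  qed
  \<comment> \<open>The unitriangular factor \<open>?U\<close> undoes the column subtractions.\<close>
  let ?M = "Matrix.mat n n (\<lambda>(p, q). \<Sum>l\<in>B q. toeplitz_entry c (r p) l)"
  let ?U = "Matrix.mat n n (\<lambda>(p, q). if p \<le> q then 1 else (0::real))"
  have "Matrix.mat n n (\<lambda>(p, q). toeplitz_entry ?c (r p) (s q)) = ?M * ?U"
  proof (rule eq_matI)
    fix p q assume "p < dim_row (?M * ?U)" "q < dim_col (?M * ?U)"
    then have pq: "p < n" "q < n" by auto
    have "(?M * ?U) $$ (p, q) = (\<Sum>q'=0..<n. (\<Sum>l\<in>B q'. toeplitz_entry c (r p) l) * (if q' \<le> q then 1 else 0))"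
      using pq by (simp add: scalar_prod_def)
    also have "\<dots> = (\<Sum>q'\<le>q. \<Sum>l\<in>B q'. toeplitz_entry c (r p) l)"
      using pq by (intro sum.mono_neutral_cong_right) auto
    finally show "Matrix.mat n n (\<lambda>(p, q). toeplitz_entry ?c (r p) (s q)) $$ (p, q) = (?M * ?U) $$ (p, q)"
      using pq by (simp add: blocks entry)
  qed auto
  moreover have "Determinant.det ?U = 1"
  proof -
    have "diag_mat ?U = replicate n 1"
      by (rule nth_equalityI) (auto simp: diag_mat_def)
    then show ?thesis
      by (subst det_upper_triangular[of _ n]) auto
  qed
  moreover have "Determinant.det ?M \<ge> 0"
  proof (rule det_ordered_column_sums_nonneg)
    show "Determinant.det (Matrix.mat n n (\<lambda>(p, q). toeplitz_entry c (r p) (t q))) \<ge> 0"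
      if "strict_mono_on {..<n} t" for t
      using TP_infinityD[OF c r that] by (simp add: toeplitz_minor_def)
    show "l < l'" if "q < q'" "q' < n" "l \<in> B q" "l' \<in> B q'" for q q' l l'
    proof -
      have "l \<le> s q" "s (q' - 1) < l'" "s q \<le> s (q' - 1)"
        using that mono[of q "q' - 1"] by (auto simp: B_def split: if_splits)
      then show ?thesis by simp
    qed
  qed
  ultimately show "toeplitz_minor ?c n r s \<ge> 0"
    by (simp add: toeplitz_minor_def det_mult[of _ n])
qed

lemma TP_infinity_const_one: "(\<lambda>_. 1) \<in> TP_infinity"
  using TP_infinity_partial_sums[OF TP_infinity_delta] by simp

lemma TP_infinity_step: "(\<lambda>k. if m \<le> k then 1 else 0) \<in> TP_infinity"
  using TP_infinity_shift[OF TP_infinity_const_one] .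

lemma TP_infinity_linear: "(\<lambda>k. real (Suc k)) \<in> TP_infinity"
  using TP_infinity_partial_sums[OF TP_infinity_const_one] by simp

section \<open>Minors of small order\<close>

lemma det_mat_2:
  "Determinant.det (Matrix.mat 2 2 f) = f (0, 0) * f (1, 1) - f (0, 1) * (f (1, 0) :: 'a :: comm_ring_1)"
  by (subst laplace_expansion_column[of _ 2 0])
    (auto simp: eval_nat_numeral cofactor_def det_single mat_delete_def)

lemma det_mat_3:
  "Determinant.det (Matrix.mat 3 3 f) =
     f (0, 0) * (f (1, 1) * f (2, 2) - f (1, 2) * f (2, 1))
   - f (1, 0) * (f (0, 1) * f (2, 2) - f (0, 2) * f (2, 1))
   + f (2, 0) * (f (0, 1) * f (1, 2) - f (0, 2) * (f (1, 1) :: 'a :: comm_ring_1))"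
proof -
  have del: "mat_delete (Matrix.mat 3 3 f) i 0 =
      Matrix.mat 2 2 (\<lambda>(p, q). f (if p < i then p else Suc p, Suc q))" for i
    by (auto simp: mat_delete_def intro!: eq_matI)
  have "{..<3::nat} = {0, 1, 2}" by auto
  then show ?thesis
    by (subst laplace_expansion_column[of _ 3 0])
      (simp_all add: cofactor_def del det_mat_2 algebra_simps flip: numeral_2_eq_2)
qed

lemma TP_infinity_nonneg:
  assumes "c \<in> TP_infinity"
  shows "c k \<ge> 0"
proof -
  have "toeplitz_minor c 1 (\<lambda>_. 0) (\<lambda>_. k) \<ge> 0"
    by (rule TP_infinityD[OF assms]) (auto simp: strict_mono_on_def)
  then show ?thesis
    by (simp add: toeplitz_minor_def det_single toeplitz_entry_def)
qed

text \<open>The minor with rows \<open>0, 1\<close> and columns \<open>k < N + 1\<close>; the entry in row 1 is \<open>c\<^sub>k\<^sub>-\<^sub>1\<close>, or 0 if \<open>k = 0\<close>.\<close>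
lemma TP_infinity_minor_2:
  assumes "c \<in> TP_infinity" "k < N"
  shows "toeplitz_entry c 1 k * c (Suc N) \<le> c k * c N"
proof -
  have "toeplitz_minor c 2 (\<lambda>p. p) (\<lambda>q. if q = 0 then k else Suc N) \<ge> 0"
    by (rule TP_infinityD[OF assms(1)]) (use assms(2) in \<open>auto simp: strict_mono_on_def\<close>)
  then show ?thesis
    by (auto simp: toeplitz_minor_def det_mat_2 toeplitz_entry_def mult.commute split: if_splits)
qed

lemma TP_infinity_log_concave:
  assumes "c \<in> TP_infinity" "k < N"
  shows "c k * c (Suc N) \<le> c (Suc k) * c N"
proof (cases "Suc k < N")
  case True
  show ?thesis using TP_infinity_minor_2[OF assms(1) True] by (simp add: toeplitz_entry_def)
next
  case False
  then have "N = Suc k" using assms(2) by simp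
  have "toeplitz_minor c 2 (\<lambda>p. p) (\<lambda>q. Suc k + q) \<ge> 0"
    by (rule TP_infinityD[OF assms(1)]) (auto simp: strict_mono_on_def)
  then show ?thesis
    using \<open>N = Suc k\<close> by (simp add: toeplitz_minor_def det_mat_2 toeplitz_entry_def mult.commute)
qed

section \<open>Backward differences of totally positive sequences\<close>

text \<open>
  The backward difference \<open>c\<^sub>k - c\<^sub>k\<^sub>-\<^sub>1\<close>, that is, the coefficient of \<open>z\<^sup>k\<close> in \<open>(1 - z) \<Sum> c\<^sub>k z\<^sup>k\<close>.
  The entry in row 1 of the Toeplitz matrix supplies the convention \<open>c\<^sub>-\<^sub>1 = 0\<close>.
\<close>
definition backward_diff :: "(nat \<Rightarrow> real) \<Rightarrow> nat \<Rightarrow> real" where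
  "backward_diff c k = c k - toeplitz_entry c 1 k"

lemma backward_diff_0: "backward_diff c 0 = c 0"
  and backward_diff_Suc: "backward_diff c (Suc k) = c (Suc k) - c k"
  by (simp_all add: backward_diff_def toeplitz_entry_def)

lemma ratio_tendsto_imp_eventually_nonzero:
  fixes c :: "nat \<Rightarrow> real"
  assumes "(\<lambda>n. c (Suc n) / c n) \<longlonglongrightarrow> \<rho>" "\<rho> > 0"
  shows "\<forall>\<^sub>F n in sequentially. c n \<noteq> 0"
  using order_tendstoD(1)[OF assms] by eventually_elim auto

text \<open>
  When the term ratios tend to 1, the generating function may be multiplied by \<open>1 - z\<close>, by letting the
  last column of a minor run to infinity: divided by one of its entries, that column tends to the
  constant vector 1, and subtracting neighbouring rows leaves a
  minor of order one less, formed from backward differences. This is done here for orders 2 and 3.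
\<close>
lemma TP_infinity_backward_diff_nonneg:
  assumes c: "c \<in> TP_infinity" and ratio: "(\<lambda>n. c (Suc n) / c n) \<longlonglongrightarrow> 1"
  shows "backward_diff c k \<ge> 0"
proof -
  have "toeplitz_entry c 1 k * 1 \<le> c k"
  proof (rule tendsto_upperbound)
    show "(\<lambda>n. toeplitz_entry c 1 k * (c (Suc n) / c n)) \<longlonglongrightarrow> toeplitz_entry c 1 k * 1"
      by (intro tendsto_intros ratio)
    have "\<forall>\<^sub>F n in sequentially. c n \<noteq> 0"
      by (rule ratio_tendsto_imp_eventually_nonzero[OF ratio]) simp
    then show "\<forall>\<^sub>F n in sequentially. toeplitz_entry c 1 k * (c (Suc n) / c n) \<le> c k"
      using eventually_gt_at_top[of k]
    proof eventually_elim
      case (elim n)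
      then have "c n > 0" using TP_infinity_nonneg[OF c, of n] by simp
      then show ?case
        using TP_infinity_minor_2[OF c \<open>k < n\<close>] by (simp add: divide_simps mult.commute)
    qed
  qed simp
  then show ?thesis by (simp add: backward_diff_def)
qed

text \<open>
  The minor with rows \<open>0, 1, 2\<close> and columns \<open>k + 1 < N + 1 < M + 2\<close>, expanded along the first column.
\<close>
lemma TP_infinity_minor_3:
  assumes "c \<in> TP_infinity" "k < N" "N \<le> M"
  shows "0 \<le> c (Suc k) * (c N * c M - c (Suc M) * toeplitz_entry c 1 N)
      - c k * (c (Suc N) * c M - c (Suc (Suc M)) * toeplitz_entry c 1 N)
      + toeplitz_entry c 1 k * (c (Suc N) * c (Suc M) - c (Suc (Suc M)) * c N)"
proof -
  let ?s = "\<lambda>q::nat. if q = 0 then Suc k else if q = 1 then Suc N else Suc (Suc M)"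
  have shift: "toeplitz_entry c (Suc 0) (Suc m) = c m" "toeplitz_entry c 2 (Suc m) = toeplitz_entry c (Suc 0) m" for m
    by (auto simp: toeplitz_entry_def)
  have entry0: "toeplitz_entry c 0 m = c m" for m
    by (simp add: toeplitz_entry_def)
  have "toeplitz_minor c 3 (\<lambda>p. p) ?s \<ge> 0"
    by (rule TP_infinityD[OF assms(1)]) (use assms(2,3) in \<open>auto simp: strict_mono_on_def\<close>)
  then show ?thesis
    by (simp add: toeplitz_minor_def det_mat_3 shift entry0)
qed

lemma TP_infinity_backward_diff_log_concave:
  assumes c: "c \<in> TP_infinity" and ratio: "(\<lambda>n. c (Suc n) / c n) \<longlonglongrightarrow> 1" and "k < N"
  shows "backward_diff c k * backward_diff c (Suc N) \<le> backward_diff c (Suc k) * backward_diff c N"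
proof -
  let ?t = "toeplitz_entry c 1"
  have nz: "\<forall>\<^sub>F n in sequentially. c n \<noteq> 0"
    by (rule ratio_tendsto_imp_eventually_nonzero[OF ratio]) simp
  have nz': "\<forall>\<^sub>F n in sequentially. c (Suc n) \<noteq> 0"
    by (rule eventually_compose_filterlim[OF nz filterlim_Suc])
  have "(\<lambda>n. c (Suc (Suc n)) / c (Suc n) * (c (Suc n) / c n)) \<longlonglongrightarrow> 1 * 1"
    by (intro tendsto_mult ratio LIMSEQ_Suc)
  moreover have "\<forall>\<^sub>F n in sequentially. c (Suc (Suc n)) / c (Suc n) * (c (Suc n) / c n) = c (Suc (Suc n)) / c n"
    using nz' by eventually_elim simp
  ultimately have ratio2: "(\<lambda>n. c (Suc (Suc n)) / c n) \<longlonglongrightarrow> 1"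
    using Lim_transform_eventually by fastforce
  have "0 \<le> c (Suc k) * (c N - 1 * ?t N) - c k * (c (Suc N) - 1 * ?t N) + ?t k * (c (Suc N) * 1 - 1 * c N)"
  proof (rule tendsto_lowerbound)
    show "(\<lambda>M. c (Suc k) * (c N - c (Suc M) / c M * ?t N)
        - c k * (c (Suc N) - c (Suc (Suc M)) / c M * ?t N)
        + ?t k * (c (Suc N) * (c (Suc M) / c M) - c (Suc (Suc M)) / c M * c N)) \<longlonglongrightarrow>
        c (Suc k) * (c N - 1 * ?t N) - c k * (c (Suc N) - 1 * ?t N) + ?t k * (c (Suc N) * 1 - 1 * c N)"
      by (intro tendsto_intros ratio ratio2)
    show "\<forall>\<^sub>F M in sequentially. 0 \<le> c (Suc k) * (c N - c (Suc M) / c M * ?t N)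
        - c k * (c (Suc N) - c (Suc (Suc M)) / c M * ?t N)
        + ?t k * (c (Suc N) * (c (Suc M) / c M) - c (Suc (Suc M)) / c M * c N)"
      using nz eventually_ge_at_top[of N]
    proof eventually_elim
      case (elim M)
      then have pos: "c M > 0" using TP_infinity_nonneg[OF c, of M] by simp
      have "0 \<le> (c (Suc k) * (c N * c M - c (Suc M) * ?t N)
          - c k * (c (Suc N) * c M - c (Suc (Suc M)) * ?t N)
          + ?t k * (c (Suc N) * c (Suc M) - c (Suc (Suc M)) * c N)) / c M"
        using TP_infinity_minor_3[OF c \<open>k < N\<close> \<open>N \<le> M\<close>] pos by simp
      also have "\<dots> = c (Suc k) * (c N - c (Suc M) / c M * ?t N)
        - c k * (c (Suc N) - c (Suc (Suc M)) / c M * ?t N)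
        + ?t k * (c (Suc N) * (c (Suc M) / c M) - c (Suc (Suc M)) / c M * c N)"
        using pos by (simp add: field_simps)
      finally show ?case .
    qed
  qed simp
  then show ?thesis
    by (simp add: backward_diff_Suc) (simp add: backward_diff_def algebra_simps)
qed

text \<open>
  Letting \<open>N\<close> run to infinity in the log-concavity of the differences gives \<open>\<rho> d\<^sub>k \<le> d\<^sub>k\<^sub>+\<^sub>1\<close>; for
  \<open>\<rho> \<ge> 1\<close> the sequence \<open>c\<close>, extended by \<open>c\<^sub>-\<^sub>1 = 0\<close>, is therefore convex.
\<close>
lemma TP_infinity_backward_diff_mono:
  assumes c: "c \<in> TP_infinity" and ratio: "(\<lambda>n. c (Suc n) / c n) \<longlonglongrightarrow> 1"
    and diff_ratio: "(\<lambda>n. backward_diff c (Suc n) / backward_diff c n) \<longlonglongrightarrow> \<rho>" and "\<rho> \<ge> 1"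
  shows "backward_diff c k \<le> backward_diff c (Suc k)"
proof -
  have nonneg: "backward_diff c n \<ge> 0" for n
    by (rule TP_infinity_backward_diff_nonneg[OF c ratio])
  have "backward_diff c k * \<rho> \<le> backward_diff c (Suc k)"
  proof (rule tendsto_upperbound)
    show "(\<lambda>n. backward_diff c k * (backward_diff c (Suc n) / backward_diff c n)) \<longlonglongrightarrow> backward_diff c k * \<rho>"
      by (intro tendsto_intros diff_ratio)
    have "\<forall>\<^sub>F n in sequentially. backward_diff c n \<noteq> 0"
      by (rule ratio_tendsto_imp_eventually_nonzero[OF diff_ratio]) (use \<open>\<rho> \<ge> 1\<close> in simp)
    then show "\<forall>\<^sub>F n in sequentially.
        backward_diff c k * (backward_diff c (Suc n) / backward_diff c n) \<le> backward_diff c (Suc k)"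
      using eventually_gt_at_top[of k]
    proof eventually_elim
      case (elim n)
      then have "backward_diff c n > 0" using nonneg[of n] by simp
      then show ?case
        using TP_infinity_backward_diff_log_concave[OF c ratio \<open>k < n\<close>] by (simp add: divide_simps)
    qed
  qed simp
  moreover have "backward_diff c k * 1 \<le> backward_diff c k * \<rho>"
    by (intro mult_left_mono nonneg \<open>\<rho> \<ge> 1\<close>)
  ultimately show ?thesis by simp
qed

text \<open>
  The hypothesis also excludes internal zeros: a zero following a nonzero term would force all later
  terms to vanish. From the first nonzero term on, the ratios are thus defined and decreasing.
\<close>
lemma log_concave_ratio_tendsto:
  fixes c :: "nat \<Rightarrow> real"
  assumes nonneg: "\<And>k. c k \<ge> 0"
    and log_concave: "\<And>k N. k < N \<Longrightarrow> c k * c (Suc N) \<le> c (Suc k) * c N"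
    and freq: "\<exists>\<^sub>F n in sequentially. c n \<noteq> 0"
  obtains \<rho> where "\<rho> \<ge> 0" "(\<lambda>n. c (Suc n) / c n) \<longlonglongrightarrow> \<rho>" "\<forall>\<^sub>F n in sequentially. c n > 0"
proof -
  obtain m where m: "c m \<noteq> 0" using frequently_ex[OF freq] by blast
  have pos: "c n > 0" if "m \<le> n" for n
    using that
  proof (induction n rule: dec_induct)
    case base
    then show ?case using m nonneg[of m] by simp
  next
    case (step n)
    obtain N where N: "N > Suc n" "c N \<noteq> 0"
      using freq unfolding frequently_sequentially by (meson Suc_le_eq)
    have "c n * c N \<le> c (Suc n) * c (N - 1)"
      using log_concave[of n "N - 1"] N by simp
    moreover have "c n * c N > 0" using step.IH N nonneg[of N] by simp
    ultimately show ?case using nonneg[of "Suc n"] by (cases "c (Suc n) = 0") auto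
  qed
  let ?q = "\<lambda>n. c (Suc (n + m)) / c (n + m)"
  have "decseq ?q"
    unfolding decseq_Suc_iff
    using log_concave[of "n + m" "Suc (n + m)" for n] pos by (auto simp: divide_simps mult.commute)
  moreover have "?q n \<ge> 0" for n using nonneg by simp
  ultimately obtain \<rho> where \<rho>: "?q \<longlonglongrightarrow> \<rho>"
    using decseq_convergent[of ?q 0] by blast
  show ?thesis
  proof
    show "(\<lambda>n. c (Suc n) / c n) \<longlonglongrightarrow> \<rho>" by (rule LIMSEQ_offset[of _ m]) (use \<rho> in simp)
    show "\<rho> \<ge> 0" by (rule LIMSEQ_le_const[OF \<rho>]) (use nonneg in auto)
    show "\<forall>\<^sub>F n in sequentially. c n > 0"
      using pos eventually_sequentially by blast
  qed
qed

lemma summable_nat_mult_ratio: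
  fixes d :: "nat \<Rightarrow> real"
  assumes pos: "\<forall>\<^sub>F n in sequentially. d n > 0"
    and ratio: "(\<lambda>n. d (Suc n) / d n) \<longlonglongrightarrow> \<rho>" and "\<rho> < 1"
  shows "summable (\<lambda>n. real n * d n)"
proof -
  obtain q where q: "\<rho> < q" "q < 1" using dense[OF \<open>\<rho> < 1\<close>] by blast
  have "(\<lambda>n. real (Suc n) / real n) \<longlonglongrightarrow> 1" by real_asymp
  then have "(\<lambda>n. real (Suc n) / real n * (d (Suc n) / d n)) \<longlonglongrightarrow> 1 * \<rho>"
    by (intro tendsto_mult ratio)
  then have "\<forall>\<^sub>F n in sequentially. real (Suc n) / real n * (d (Suc n) / d n) < q"
    by (rule order_tendstoD) (use q in simp)
  moreover have "\<forall>\<^sub>F n in sequentially. d (Suc n) > 0"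
    by (rule eventually_compose_filterlim[OF pos filterlim_Suc])
  ultimately have "\<forall>\<^sub>F n in sequentially. norm (real (Suc n) * d (Suc n)) \<le> q * norm (real n * d n)"
    using pos eventually_gt_at_top[of 0]
  proof eventually_elim
    case (elim n)
    then show ?case by (simp add: divide_simps abs_mult mult_ac split: if_splits)
  qed
  then obtain N where "\<And>n. n \<ge> N \<Longrightarrow> norm (real (Suc n) * d (Suc n)) \<le> q * norm (real n * d n)"
    unfolding eventually_sequentially by blast
  then show ?thesis by (rule summable_ratio_test[OF \<open>q < 1\<close>])
qed

section \<open>Preservers with term ratio tending to one are constant\<close>

text \<open>
  Let \<open>d\<close> be the sequence of backward differences of \<open>a\<close>; it is nonnegative and log-concave.
  If \<open>\<Sum> k d\<^sub>k\<close> converges, then \<open>a\<close> increases to a limit \<open>L\<close> with \<open>(k + 1) (L - a\<^sub>k) \<rightarrow> 0\<close>.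
  The image of \<open>(k + 1)\<^sub>k\<close> is then convex and approaches the line \<open>(k + 1) L\<close>, which meets it at
  \<open>k = -1\<close>, where both vanish. A convex sequence that meets its asymptote coincides with it from there on, so
  \<open>a\<close> is constant. If the sum diverges, the ratios of \<open>d\<close> have a limit of at least 1, and
  convexity of the truncations of \<open>a\<close>, which are the images of the step sequences, forces
  \<open>a\<close> to double at every index.
\<close>
lemma TP_preserver_ratio_one_imp_const:
  fixes a :: "nat \<Rightarrow> real"
  assumes preserves: "\<And>b. b \<in> TP_infinity \<Longrightarrow> Lambda_op a b \<in> TP_infinity"
    and ratio: "(\<lambda>n. a (Suc n) / a n) \<longlonglongrightarrow> 1"
  obtains L where "L > 0" "\<And>k. a k = L"
proof -
  let ?d = "backward_diff a"
  have a: "a \<in> TP_infinity"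
    using preserves[OF TP_infinity_const_one] by (simp add: Lambda_op_def)
  have d_nonneg: "?d k \<ge> 0" for k
    by (rule TP_infinity_backward_diff_nonneg[OF a ratio])
  have a_mono: "a k \<le> a (Suc k)" for k
    using d_nonneg[of "Suc k"] by (simp add: backward_diff_Suc)
  have a_incseq: "incseq a" using a_mono by (simp add: incseq_Suc_iff)
  have a_pos: "\<forall>\<^sub>F n in sequentially. a n > 0"
  proof -
    have "\<forall>\<^sub>F n in sequentially. a n \<noteq> 0"
      by (rule ratio_tendsto_imp_eventually_nonzero[OF ratio]) simp
    then show ?thesis by eventually_elim (use TP_infinity_nonneg[OF a] in \<open>simp add: less_le\<close>)
  qed
  show thesis
  proof (cases "summable (\<lambda>k. real k * ?d k)")
    case True
    define S where "S n = (\<Sum>k\<le>n. real k * ?d k)" for n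
    define S' where "S' = (\<Sum>k. real k * ?d k)"
    have S: "S \<longlonglongrightarrow> S'"
      using summable_LIMSEQ'[OF True] by (simp add: S_def[abs_def] S'_def)
    have S_le: "S n \<le> S'" for n
      unfolding S_def S'_def by (rule sum_le_suminf[OF True]) (auto simp: d_nonneg)
    \<comment> \<open>The weight \<open>k + 1\<close> is at most the index of every difference occurring in \<open>a n - a k\<close>.\<close>
    have tail: "real (Suc k) * (a n - a k) \<le> S n - S k" if "k \<le> n" for k n
      using that
    proof (induction n rule: dec_induct)
      case (step n)
      have "real (Suc k) * (a (Suc n) - a n) \<le> real (Suc n) * (a (Suc n) - a n)"
        using step.hyps a_mono[of n] by (intro mult_right_mono) auto
      then show ?case
        using step.IH by (simp add: S_def backward_diff_Suc algebra_simps)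
    qed simp
    have "a n \<le> a 0 + S'" for n
      using tail[of 0 n] S_le[of n] by (simp add: S_def)
    then obtain L where L: "a \<longlonglongrightarrow> L"
      using incseq_convergent[OF a_incseq] by blast
    have a_le: "a n \<le> L" for n by (rule incseq_le[OF a_incseq L])
    have "L > 0"
      using eventually_happens[OF a_pos] a_le by (force intro: less_le_trans)
    have tail': "real (Suc k) * (L - a k) \<le> S' - S k" for k
    proof (rule LIMSEQ_le)
      show "(\<lambda>n. real (Suc k) * (a n - a k)) \<longlonglongrightarrow> real (Suc k) * (L - a k)"
        by (intro tendsto_intros L)
      show "(\<lambda>n. S n - S k) \<longlonglongrightarrow> S' - S k"
        by (intro tendsto_intros S)
    qed (use tail in blast)
    define c where "c k = a k * real (Suc k)" for k
    have c: "c \<in> TP_infinity"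
      using preserves[OF TP_infinity_linear] by (simp add: Lambda_op_def c_def[abs_def])
    have c_ratio: "(\<lambda>n. c (Suc n) / c n) \<longlonglongrightarrow> 1"
    proof -
      have "(\<lambda>n. real (Suc (Suc n)) / real (Suc n)) \<longlonglongrightarrow> 1" by real_asymp
      then have "(\<lambda>n. a (Suc n) / a n * (real (Suc (Suc n)) / real (Suc n))) \<longlonglongrightarrow> 1 * 1"
        by (intro tendsto_mult ratio)
      then show ?thesis by (simp add: c_def)
    qed
    have c_diff: "backward_diff c k = a k + real k * ?d k" for k
      by (cases k) (auto simp: c_def backward_diff_0 backward_diff_Suc algebra_simps)
    have c_diff_tendsto: "backward_diff c \<longlonglongrightarrow> L"
    proof -
      have "(\<lambda>k. a k + real k * ?d k) \<longlonglongrightarrow> L + 0"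
        by (intro tendsto_add L summable_LIMSEQ_zero[OF True])
      then show ?thesis by (simp add: c_diff[abs_def])
    qed
    have "backward_diff c k \<le> backward_diff c (Suc k)" for k
    proof (rule TP_infinity_backward_diff_mono[OF c c_ratio])
      show "(\<lambda>n. backward_diff c (Suc n) / backward_diff c n) \<longlonglongrightarrow> L / L"
        by (intro tendsto_divide LIMSEQ_Suc c_diff_tendsto) (use \<open>L > 0\<close> in simp)
    qed (use \<open>L > 0\<close> in simp)
    then have c_diff_le: "backward_diff c k \<le> L" for k
      by (intro incseq_le[OF _ c_diff_tendsto]) (simp add: incseq_Suc_iff)
    \<comment> \<open>\<open>h\<close> is the excess of \<open>c\<close> over its asymptote; decreasing to 0, it is nonnegative, although \<open>a \<le> L\<close>.\<close>
    define h where "h k = real (Suc k) * (a k - L)" for k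
    have "decseq h"
      unfolding decseq_Suc_iff
    proof
      fix k
      show "h (Suc k) \<le> h k"
        using c_diff_le[of "Suc k"] by (simp add: h_def c_def backward_diff_Suc algebra_simps)
    qed
    moreover have "h \<longlonglongrightarrow> 0"
    proof (rule tendsto_sandwich)
      show "(\<lambda>k. S k - S') \<longlonglongrightarrow> 0"
        using tendsto_diff[OF S tendsto_const[of S']] by simp
      show "\<forall>\<^sub>F k in sequentially. S k - S' \<le> h k"
        using tail' by (simp add: h_def algebra_simps)
      show "\<forall>\<^sub>F k in sequentially. h k \<le> 0"
        using a_le by (simp add: h_def mult_nonneg_nonpos)
    qed simp
    ultimately have "h k \<ge> 0" for k by (rule decseq_ge)
    then have "a k \<ge> L" for k by (simp add: h_def zero_le_mult_iff)
    then show thesis using that[OF \<open>L > 0\<close>] a_le by (meson antisym)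
  next
    case False
    have "\<exists>\<^sub>F n in sequentially. ?d n \<noteq> 0"
    proof (rule ccontr)
      assume "\<not> ?thesis"
      then have "\<forall>\<^sub>F n in sequentially. real n * ?d n = 0"
        unfolding not_frequently by eventually_elim simp
      from summable_cong[OF this] show False using False by simp
    qed
    then obtain \<rho> where \<rho>: "\<rho> \<ge> 0" "(\<lambda>n. ?d (Suc n) / ?d n) \<longlonglongrightarrow> \<rho>" "\<forall>\<^sub>F n in sequentially. ?d n > 0"
      using log_concave_ratio_tendsto[of ?d, OF d_nonneg TP_infinity_backward_diff_log_concave[OF a ratio]]
      by blast
    have "\<rho> \<ge> 1"
      using summable_nat_mult_ratio[OF \<rho>(3,2)] False by linarith
    have doubling: "2 * a j \<le> a (Suc j)" for j
    proof -
      define c where "c k = a k * (if j \<le> k then 1 else 0)" for k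
      have c: "c \<in> TP_infinity"
        using preserves[OF TP_infinity_step[of j]] by (simp add: Lambda_op_def c_def[abs_def])
      have "(\<lambda>n. c (Suc n) / c n) \<longlonglongrightarrow> 1"
      proof (rule Lim_transform_eventually[OF ratio])
        show "\<forall>\<^sub>F n in sequentially. a (Suc n) / a n = c (Suc n) / c n"
          using eventually_ge_at_top[of j] by eventually_elim (simp add: c_def)
      qed
      moreover have "(\<lambda>n. backward_diff c (Suc n) / backward_diff c n) \<longlonglongrightarrow> \<rho>"
      proof (rule Lim_transform_eventually[OF \<rho>(2)])
        have "backward_diff c (Suc n) = ?d (Suc n)" if "n \<ge> j" for n
          using that by (simp add: c_def backward_diff_Suc)
        then have diff_eq: "backward_diff c n = ?d n" if "n > j" for n
          using that by (cases n) auto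
        show "\<forall>\<^sub>F n in sequentially. ?d (Suc n) / ?d n = backward_diff c (Suc n) / backward_diff c n"
          using eventually_gt_at_top[of j] by eventually_elim (simp add: diff_eq)
      qed
      \<comment> \<open>As \<open>c\<close> vanishes before index \<open>j\<close>, these two differences are \<open>a j\<close> and \<open>a (Suc j) - a j\<close>.\<close>
      ultimately have "backward_diff c j \<le> backward_diff c (Suc j)"
        using TP_infinity_backward_diff_mono[OF c] \<open>\<rho> \<ge> 1\<close> by blast
      then show ?thesis
        by (cases j) (auto simp: c_def backward_diff_0 backward_diff_Suc)
    qed
    have "\<forall>\<^sub>F n in sequentially. a (Suc n) / a n \<ge> 2"
      using a_pos by eventually_elim (use doubling in \<open>simp add: divide_simps\<close>)
    then have "(2::real) \<le> 1"
      by (intro tendsto_lowerbound[OF ratio]) auto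
    then show thesis by simp
  qed
qed

section \<open>Preservers with finite radius of convergence are geometric\<close>

lemma conv_radius_infinity_imp_no_pole:
  assumes "meromorphic_generating_function a A" "conv_radius a = \<infinity>"
  shows "\<not> is_pole A z"
proof -
  have "A holomorphic_on ball 0 (norm z + 1)"
    by (rule power_series_holomorphic[where a = "\<lambda>k. complex_of_real (a k)"])
      (use assms in \<open>simp add: meromorphic_generating_function_def\<close>)
  then show ?thesis
    by (intro not_is_pole_holomorphic[of "ball 0 (norm z + 1)"]) auto
qed

lemma TP_preserver_imp_geometric:
  fixes a :: "nat \<Rightarrow> real"
  assumes preserves: "\<And>b. b \<in> TP_infinity \<Longrightarrow> Lambda_op a b \<in> TP_infinity"
    and radius: "conv_radius a \<noteq> \<infinity>"
  obtains C \<beta> where "C > 0" "\<beta> > 0" "\<And>k. a k = C * \<beta> ^ k"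
proof -
  have a: "a \<in> TP_infinity"
    using preserves[OF TP_infinity_const_one] by (simp add: Lambda_op_def)
  have "\<exists>\<^sub>F n in sequentially. a n \<noteq> 0"
  proof (rule ccontr)
    assume "\<not> ?thesis"
    then have "\<forall>\<^sub>F n in sequentially. a n = 0" by (simp add: not_frequently)
    then have "conv_radius a = conv_radius (\<lambda>_. 0 :: real)" by (rule conv_radius_cong')
    then show False using radius by simp
  qed
  then obtain \<beta> where \<beta>: "\<beta> \<ge> 0" "(\<lambda>n. a (Suc n) / a n) \<longlonglongrightarrow> \<beta>" "\<forall>\<^sub>F n in sequentially. a n > 0"
    using log_concave_ratio_tendsto[of a, OF TP_infinity_nonneg[OF a] TP_infinity_log_concave[OF a]]
    by blast
  have "\<beta> \<noteq> 0"
  proof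
    assume "\<beta> = 0"
    have "\<forall>\<^sub>F n in sequentially. a (Suc n) > 0"
      by (rule eventually_compose_filterlim[OF \<beta>(3) filterlim_Suc])
    with \<beta>(3) have "\<forall>\<^sub>F n in sequentially. a (Suc n) / a n > 0"
      by eventually_elim simp
    with \<beta>(2) have "filterlim (\<lambda>n. inverse (a (Suc n) / a n)) at_top sequentially"
      unfolding \<open>\<beta> = 0\<close> by (rule filterlim_inverse_at_top)
    then have "filterlim (\<lambda>n. norm (a n) / norm (a (Suc n))) at_top sequentially"
      by (simp add: TP_infinity_nonneg[OF a] abs_of_nonneg)
    then have "(\<lambda>n. ereal (norm (a n) / norm (a (Suc n)))) \<longlonglongrightarrow> \<infinity>"
      by (simp add: tendsto_PInfty_eq_at_top)
    then have "conv_radius a = \<infinity>"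
      by (intro conv_radius_ratio_limit_ereal_nonzero) simp
    then show False using radius by simp
  qed
  with \<beta>(1) have \<beta>_pos: "\<beta> > 0" by simp
  \<comment> \<open>Rescaling by the limiting ratio reduces to the case of ratio 1.\<close>
  define a' where "a' k = a k / \<beta> ^ k" for k
  have "Lambda_op a' b \<in> TP_infinity" if "b \<in> TP_infinity" for b
  proof -
    have "(\<lambda>k. 1 * (1 / \<beta>) ^ k * Lambda_op a b k) \<in> TP_infinity"
      by (rule TP_infinity_geometric_scale[OF preserves[OF that]]) (use \<beta>_pos in auto)
    then show ?thesis
      by (simp add: Lambda_op_def[abs_def] a'_def power_one_over field_simps)
  qed
  moreover have "(\<lambda>n. a' (Suc n) / a' n) \<longlonglongrightarrow> 1"
  proof -
    have "(\<lambda>n. a (Suc n) / a n / \<beta>) \<longlonglongrightarrow> \<beta> / \<beta>"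
      by (intro tendsto_intros \<beta>(2)) (use \<beta>_pos in simp)
    moreover have "a' (Suc n) / a' n = a (Suc n) / a n / \<beta>" for n
      using \<beta>_pos by (simp add: a'_def)
    ultimately show ?thesis using \<beta>_pos by simp
  qed
  ultimately obtain L where L: "L > 0" "\<And>k. a' k = L"
    using TP_preserver_ratio_one_imp_const by blast
  show ?thesis
  proof
    show "a k = L * \<beta> ^ k" for k
      using L(2)[of k] \<beta>_pos by (simp add: a'_def field_simps)
  qed (use L \<beta>_pos in auto)
qed

section \<open>Coefficients and their meromorphic generating functions\<close>

lemma has_fps_expansion_geometric:
  fixes C \<beta> :: complex
  shows "(\<lambda>z. C / (1 - \<beta> * z)) has_fps_expansion Abs_fps (\<lambda>k. C * \<beta> ^ k)"
proof (rule has_fps_expansionI)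
  have "((\<lambda>z. norm (\<beta> * z)) \<longlongrightarrow> norm (\<beta> * 0)) (nhds 0)"
    by (intro tendsto_intros filterlim_ident)
  then have "\<forall>\<^sub>F z in nhds 0. norm (\<beta> * z) < 1"
    by (rule order_tendstoD) simp
  then show "\<forall>\<^sub>F z in nhds 0. (\<lambda>k. fps_nth (Abs_fps (\<lambda>k. C * \<beta> ^ k)) k * z ^ k) sums (C / (1 - \<beta> * z))"
  proof eventually_elim
    case (elim z)
    from sums_mult[OF geometric_sums[OF this], of C] show ?case
      by (simp add: power_mult_distrib mult_ac)
  qed
qed

lemma meromorphic_generating_function_has_fps_expansion:
  assumes "meromorphic_generating_function a A"
  shows "A has_fps_expansion Abs_fps (\<lambda>k. complex_of_real (a k))"
proof (rule has_fps_expansionI)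
  have "\<forall>\<^sub>F z in nhds 0. z \<in> eball (0::complex) (conv_radius a)"
    using assms by (intro eventually_nhds_in_open) (auto simp: meromorphic_generating_function_def zero_ereal_def)
  then show "\<forall>\<^sub>F z in nhds 0. (\<lambda>k. fps_nth (Abs_fps (\<lambda>k. complex_of_real (a k))) k * z ^ k) sums A z"
    by eventually_elim (use assms in \<open>simp add: meromorphic_generating_function_def\<close>)
qed

text \<open>
  The identity theorem for meromorphic functions gives the equality off a sparse set. Both sides are
  continuous wherever \<open>A\<close> has no pole and the denominator is nonzero, which removes the exceptional
  points other than the zero of the denominator.
\<close>
lemma nicely_meromorphic_eq_quotient:
  fixes A :: "complex \<Rightarrow> complex"
  assumes A: "A nicely_meromorphic_on UNIV"
    and near: "\<forall>\<^sub>F z in nhds 0. A z = C / (1 - \<beta> * z)"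
    and z: "1 - \<beta> * z \<noteq> 0"
  shows "A z = C / (1 - \<beta> * z)"
proof -
  let ?g = "\<lambda>z. C / (1 - \<beta> * z)"
  have "(\<lambda>z. A z - ?g z) meromorphic_on UNIV"
    using A by (auto simp: nicely_meromorphic_on_def intro!: meromorphic_intros)
  then have "(\<forall>\<^sub>F w in cosparse UNIV. A w - ?g w = 0) \<or> (\<forall>\<^sub>F w in cosparse UNIV. A w - ?g w \<noteq> 0)"
    by (rule meromorphic_imp_constant_or_avoid) auto
  moreover have "\<not> (\<forall>\<^sub>F w in cosparse UNIV. A w - ?g w \<noteq> 0)"
  proof
    assume "\<forall>\<^sub>F w in cosparse UNIV. A w - ?g w \<noteq> 0"
    then have "\<forall>\<^sub>F w in at 0. A w - ?g w \<noteq> 0"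
      by (simp add: eventually_cosparse_open_eq)
    moreover have "\<forall>\<^sub>F w in at 0. A w = ?g w"
      using near by (auto simp: eventually_at_filter elim: eventually_mono)
    ultimately have "\<forall>\<^sub>F w in at (0::complex). False"
      by eventually_elim simp
    then show False by simp
  qed
  ultimately have "\<forall>\<^sub>F w in at z. A w = ?g w"
    by (auto simp: eventually_cosparse_open_eq)
  moreover have "?g \<midarrow>z\<rightarrow> ?g z"
    by (intro tendsto_intros z)
  ultimately have lim: "A \<midarrow>z\<rightarrow> ?g z"
    by (subst tendsto_cong)
  then have "\<not> is_pole A z"
    using not_tendsto_and_filterlim_at_infinity[of "at z" A] by (auto simp: is_pole_def)
  then have "A \<midarrow>z\<rightarrow> A z"
    using A by (auto simp: nicely_meromorphic_on_def)
  then show ?thesis using lim by (rule LIM_unique)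
qed

theorem theorem1p7:
  fixes a :: "nat \<Rightarrow> real" and A :: "complex \<Rightarrow> complex"
  assumes "\<And>k. a k \<ge> 0"
    and "meromorphic_generating_function a A"
    and "\<exists>z. is_pole A z"
  shows "(\<forall>b \<in> TP_infinity. Lambda_op a b \<in> TP_infinity) \<longleftrightarrow>
    (\<exists>C \<beta> :: real. C > 0 \<and> \<beta> > 0 \<and>
      (\<forall>z. 1 - complex_of_real \<beta> * z \<noteq> 0 \<longrightarrow>
         A z = complex_of_real C / (1 - complex_of_real \<beta> * z)))"
proof
  note A_fps = meromorphic_generating_function_has_fps_expansion[OF assms(2)]
  show "\<exists>C \<beta> :: real. C > 0 \<and> \<beta> > 0 \<and>
      (\<forall>z. 1 - complex_of_real \<beta> * z \<noteq> 0 \<longrightarrow> A z = complex_of_real C / (1 - complex_of_real \<beta> * z))"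
    if preserves: "\<forall>b \<in> TP_infinity. Lambda_op a b \<in> TP_infinity"
  proof -
    have "conv_radius a \<noteq> \<infinity>"
      using conv_radius_infinity_imp_no_pole[OF assms(2)] assms(3) by blast
    then obtain C \<beta> where C: "C > 0" "\<beta> > 0" "\<And>k. a k = C * \<beta> ^ k"
      using TP_preserver_imp_geometric[of a] preserves by blast
    have "A has_fps_expansion Abs_fps (\<lambda>k. complex_of_real C * complex_of_real \<beta> ^ k)"
      using A_fps by (simp add: C(3))
    with has_fps_expansion_geometric[of "complex_of_real C" "complex_of_real \<beta>"]
    have "\<forall>\<^sub>F z in nhds 0. A z = complex_of_real C / (1 - complex_of_real \<beta> * z)"
      unfolding has_fps_expansion_def by (auto elim: eventually_elim2)
    then show ?thesis
      using C(1,2) nicely_meromorphic_eq_quotient assms(2)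
      unfolding meromorphic_generating_function_def by blast
  qed
  show "\<forall>b \<in> TP_infinity. Lambda_op a b \<in> TP_infinity"
    if quotient: "\<exists>C \<beta> :: real. C > 0 \<and> \<beta> > 0 \<and>
      (\<forall>z. 1 - complex_of_real \<beta> * z \<noteq> 0 \<longrightarrow> A z = complex_of_real C / (1 - complex_of_real \<beta> * z))"
  proof -
    obtain C \<beta> :: real where C: "C > 0" "\<beta> > 0"
      and A: "\<And>z. 1 - complex_of_real \<beta> * z \<noteq> 0 \<Longrightarrow> A z = complex_of_real C / (1 - complex_of_real \<beta> * z)"
      using quotient by blast
    have "\<forall>\<^sub>F z in nhds 0. 1 - complex_of_real \<beta> * z \<noteq> 0"
    proof (rule tendsto_imp_eventually_ne)
      show "((\<lambda>z. 1 - complex_of_real \<beta> * z) \<longlongrightarrow> 1 - complex_of_real \<beta> * 0) (nhds 0)"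
        by (intro tendsto_intros filterlim_ident)
    qed simp
    then have "\<forall>\<^sub>F z in nhds 0. A z = complex_of_real C / (1 - complex_of_real \<beta> * z)"
      by eventually_elim (rule A)
    then have "A has_fps_expansion Abs_fps (\<lambda>k. complex_of_real C * complex_of_real \<beta> ^ k)"
      using has_fps_expansion_geometric by (subst has_fps_expansion_cong) auto
    from fps_expansion_unique_complex[OF A_fps this]
    have "complex_of_real (a k) = complex_of_real (C * \<beta> ^ k)" for k
      by (simp add: fps_eq_iff)
    then have "a k = C * \<beta> ^ k" for k
      using of_real_eq_iff by blast
    then have "Lambda_op a b = (\<lambda>k. C * \<beta> ^ k * b k)" for b
      by (simp add: Lambda_op_def)
    then show ?thesis
      using TP_infinity_geometric_scale C by simp
  qed
qed

end
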